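(* Let $n\ge 1$, $0<\alpha<2$, and let $G\in C^1(\mathbb{R})$ satisfy $G(0)=0$ and $G'(t)\ge c_0>0$ for all $t\in\mathbb{R}$, for some constant $c_0$. Let $\Omega$ be a bounded domain in $\mathbb{R}^n$. Assume that $u\in C^{1,1}_{loc}(\Omega)\cap L_\alpha$ is lower semi-continuous on $\bar\Omega$ and satisfies $$F_\alpha(u(x))\ge 0 \ \text{ for } x\in\Omega,\qquad u(x)\ge 0\ \text{ for } x\in\Omega^c=\mathbb{R}^n\setminus\Omega.$$ Then $u(x)\ge 0$ for all $x\in\Omega$. The same conclusion holds for unbounded domains $\Omega$ if one further assumes that $\liminf_{|x|\to\infty}u(x)\ge 0$.
   Context: For $0<\alpha<2$, $$F_\alpha(u(x)) = C_{n,\alpha}\lim_{\epsilon\to0}\int_{\mathbb{R}^n\setminus B_\epsilon(x)}\frac{G(u(x)-u(z))}{|x-z|^{n+\alpha}}\,dz,$$ where $C_{n,\alpha}>0$ is a constant depending only on $n$ and $\alpha$. A condition on $F_\alpha(u(x))$ presupposes that this limit exists and is finite at the points $x$ in question. The space $L_\alpha$ is $$L_\alpha=\Big\{u\in L^1_{loc}(\mathbb{R}^n)\ :\ \int_{\mathbb{R}^n}\frac{|u(x)|}{1+|x|^{n+\alpha}}\,dx<\infty\Big\}.$$ Functions are real-valued and defined at every point of $\mathbb{R}^n$. *)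

theory Defs
  imports "HOL-Analysis.Analysis"
begin

definition C11_loc :: "(real ^ 'n) set \<Rightarrow> (real ^ 'n \<Rightarrow> real) \<Rightarrow> bool" where
  "C11_loc \<Omega> u \<longleftrightarrow>
     (\<exists>Du. (\<forall>x\<in>\<Omega>. GDERIV u x :> Du x) \<and>
           (\<forall>K. compact K \<and> K \<subseteq> \<Omega> \<longrightarrow> (\<exists>L. L-lipschitz_on K Du)))"

definition L_space :: "real \<Rightarrow> (real ^ 'n \<Rightarrow> real) set" where
  "L_space \<alpha> =
     {u. (\<forall>K. compact K \<longrightarrow> u absolutely_integrable_on K) \<and>
         integrable lebesgue (\<lambda>x. \<bar>u x\<bar> / (1 + norm x powr (real CARD('n) + \<alpha>)))}"

text \<open>Only the values of \<open>u\<close> on \<open>S\<close> are taken into account.\<close>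

definition lower_semicontinuous_on :: "'a::topological_space set \<Rightarrow> ('a \<Rightarrow> real) \<Rightarrow> bool" where
  "lower_semicontinuous_on S u \<longleftrightarrow>
     (\<forall>x\<in>S. \<forall>a<u x. eventually (\<lambda>y. a < u y) (at x within S))"

definition F_integrand ::
    "real \<Rightarrow> (real \<Rightarrow> real) \<Rightarrow> (real ^ 'n \<Rightarrow> real) \<Rightarrow> real ^ 'n \<Rightarrow> real ^ 'n \<Rightarrow> real" where
  "F_integrand \<alpha> G u x z = G (u x - u z) / norm (x - z) powr (real CARD('n) + \<alpha>)"

definition F_truncated ::
    "real \<Rightarrow> (real \<Rightarrow> real) \<Rightarrow> (real ^ 'n \<Rightarrow> real) \<Rightarrow> real ^ 'n \<Rightarrow> real \<Rightarrow> real" where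
  "F_truncated \<alpha> G u x \<epsilon> = (LINT z:UNIV - ball x \<epsilon>|lebesgue. F_integrand \<alpha> G u x z)"

text \<open>The value of \<open>F_op\<close> is meaningful only where \<open>F_exists\<close> holds: a truncated integral that
  does not exist would be \<open>0\<close> by convention, and \<open>Lim\<close> is unspecified if there is no limit.
  The argument \<open>C\<close> is the normalisation constant.\<close>

definition F_exists ::
    "real \<Rightarrow> (real \<Rightarrow> real) \<Rightarrow> (real ^ 'n \<Rightarrow> real) \<Rightarrow> real ^ 'n \<Rightarrow> bool" where
  "F_exists \<alpha> G u x \<longleftrightarrow>
     (\<forall>\<epsilon>>0. set_integrable lebesgue (UNIV - ball x \<epsilon>) (F_integrand \<alpha> G u x)) \<and>
     (\<exists>l. (F_truncated \<alpha> G u x \<longlongrightarrow> l) (at_right 0))"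

definition F_op ::
    "real \<Rightarrow> real \<Rightarrow> (real \<Rightarrow> real) \<Rightarrow> (real ^ 'n \<Rightarrow> real) \<Rightarrow> real ^ 'n \<Rightarrow> real" where
  "F_op C \<alpha> G u x = C * Lim (at_right 0) (F_truncated \<alpha> G u x)"

end

(* If u took a negative value it would attain a negative global minimum at some x0 in \<Omega>, because u
   is lower semicontinuous and stays above any negative level near infinity. There the integrand
   G (u x0 - u z) / |x0 - z|^(n + \<alpha>) is nonpositive for all z, so the truncated integrals decrease
   as \<epsilon> tends to 0; since their limit is nonnegative they all vanish. Hence u = u x0 almost
   everywhere away from x0, contradicting u > u x0 near infinity. *)
theory Submission
  imports Defs
begin

lemma lower_semicontinuous_on_subset:
  assumes "lower_semicontinuous_on S u" "T \<subseteq> S"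
  shows "lower_semicontinuous_on T u"
  using assms unfolding lower_semicontinuous_on_def
  by (auto dest!: subsetD intro: filter_leD[OF at_le[OF assms(2)]])

lemma lower_semicontinuous_on_openin_superlevel:
  assumes "lower_semicontinuous_on S u"
  shows "openin (top_of_set S) {x \<in> S. a < u x}"
proof (subst openin_subopen, intro ballI)
  fix x assume x: "x \<in> {x \<in> S. a < u x}"
  then have "eventually (\<lambda>y. a < u y) (at x within S)"
    using assms by (auto simp: lower_semicontinuous_on_def)
  then obtain V where V: "open V" "x \<in> V" "\<forall>y\<in>V. y \<noteq> x \<longrightarrow> y \<in> S \<longrightarrow> a < u y"
    by (auto simp: eventually_at_topological)
  show "\<exists>T. openin (top_of_set S) T \<and> x \<in> T \<and> T \<subseteq> {x \<in> S. a < u x}"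
    \<comment> \<open>The filter \<open>at x within S\<close> says nothing about \<open>x\<close>
      itself; there the inequality comes from the membership of \<open>x\<close> in the superlevel
      set.\<close>
    using V x by (intro exI[of _ "S \<inter> V"]) auto
qed

text \<open>Without a minimum, the relatively open sets \<open>{x \<in> K. u y < u x}\<close> with
  \<open>y\<close> in \<open>K\<close> would cover \<open>K\<close>. Among the indices of a finite
  subcover, one with the least value of \<open>u\<close> lies in no member of it.\<close>

lemma lower_semicontinuous_on_attains_min:
  assumes K: "compact K" "K \<noteq> {}" and u: "lower_semicontinuous_on K u"
  obtains x where "x \<in> K" "\<And>y. y \<in> K \<Longrightarrow> u x \<le> u y"
proof -
  have "\<exists>x\<in>K. \<forall>y\<in>K. u x \<le> u y"
  proof (rule ccontr)
    assume no_min: "\<not> (\<exists>x\<in>K. \<forall>y\<in>K. u x \<le> u y)"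
    define U where "U y = {x \<in> K. u y < u x}" for y
    have "\<forall>T\<in>U ` K. openin (top_of_set K) T"
      unfolding U_def using lower_semicontinuous_on_openin_superlevel[OF u] by blast
    moreover have "K \<subseteq> \<Union> (U ` K)"
    proof
      fix x assume "x \<in> K"
      with no_min obtain y where "y \<in> K" "u y < u x" by (meson not_le)
      with \<open>x \<in> K\<close> show "x \<in> \<Union> (U ` K)" by (auto simp: U_def)
    qed
    ultimately obtain D where D: "D \<subseteq> U ` K" "finite D" "K \<subseteq> \<Union> D"
      using K(1)[unfolded compact_eq_openin_cover, rule_format, of "U ` K"] by auto
    then obtain Y where Y: "Y \<subseteq> K" "finite Y" "D = U ` Y"
      by (meson finite_subset_image)
    with D K(2) have "Y \<noteq> {}" by auto
    then obtain y where y: "y \<in> Y" "\<And>z. z \<in> Y \<Longrightarrow> u y \<le> u z"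
      using arg_min_if_finite(1)[OF Y(2)] arg_min_least[OF Y(2)] by blast
    with D Y obtain z where "z \<in> Y" "y \<in> U z" by blast
    with y(2)[of z] show False by (simp add: U_def)
  qed
  then show ?thesis using that by blast
qed

lemma strict_mono_if_deriv_pos:
  fixes G :: "real \<Rightarrow> real"
  assumes "G C1_differentiable_on UNIV" and "\<And>t. deriv G t > 0"
  shows "strict_mono G"
proof (rule strict_monoI)
  fix s t :: real assume "s < t"
  have "(G has_real_derivative deriv G r) (at r)" for r
    using assms(1) unfolding C1_differentiable_on_eq
    by (metis UNIV_I differentiable_def DERIV_deriv_iff_real_differentiable)
  with assms(2) \<open>s < t\<close> show "G s < G t"
    by (blast intro: DERIV_pos_imp_increasing)
qed

text \<open>Shrinking the excised ball only adds nonpositive mass, so the truncation at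
  \<open>r\<close> bounds the limit from above. Its integral is thus both nonnegative and
  nonpositive, and an integrand of constant sign with zero integral vanishes almost
  everywhere.\<close>

lemma F_integrand_eq_0_AE_if_nonpos:
  assumes "F_exists \<alpha> G u x" and "F_op C \<alpha> G u x \<ge> 0" and "C > 0"
    and nonpos: "\<And>z. F_integrand \<alpha> G u x z \<le> 0" and "r > 0"
  shows "AE z in lebesgue. z \<notin> ball x r \<longrightarrow> F_integrand \<alpha> G u x z = 0"
proof -
  let ?f = "F_integrand \<alpha> G u x"
  let ?g = "\<lambda>e z. indicator (UNIV - ball x e) z *\<^sub>R ?f z"
  have int: "integrable lebesgue (?g e)" if "e > 0" for e
    using assms(1) that by (auto simp: F_exists_def set_integrable_def)
  have F: "F_truncated \<alpha> G u x e = integral\<^sup>L lebesgue (?g e)" for e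
    by (simp add: F_truncated_def set_lebesgue_integral_def)
  obtain l where l: "(F_truncated \<alpha> G u x \<longlongrightarrow> l) (at_right 0)"
    using assms(1) by (auto simp: F_exists_def)
  \<comment> \<open>As \<open>at_right 0\<close> is a nontrivial filter, \<open>Lim\<close> is the
    limit \<open>l\<close>, and the positive factor \<open>C\<close> cancels.\<close>
  have "l \<ge> 0"
    using assms(2,3) tendsto_Lim[OF trivial_limit_at_right_real l]
    by (simp add: F_op_def zero_le_mult_iff)
  have "F_truncated \<alpha> G u x e \<le> F_truncated \<alpha> G u x r" if "0 < e" "e < r" for e
    unfolding F
    using that nonpos by (intro integral_mono int) (auto simp: indicator_def)
  then have "\<forall>\<^sub>F e in at_right 0. F_truncated \<alpha> G u x e \<le> F_truncated \<alpha> G u x r"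
    using \<open>r > 0\<close> by (auto simp: eventually_at_right_field)
  with l have "l \<le> F_truncated \<alpha> G u x r"
    by (intro tendsto_upperbound) auto
  with \<open>l \<ge> 0\<close> have "0 \<le> integral\<^sup>L lebesgue (?g r)" by (simp add: F)
  moreover have "integral\<^sup>L lebesgue (?g r) \<le> 0"
    using nonpos Bochner_Integration.integral_nonneg[of lebesgue "\<lambda>z. - ?g r z"]
    by (simp add: indicator_def)
  ultimately have "integral\<^sup>L lebesgue (\<lambda>z. - ?g r z) = 0" by simp
  then have "AE z in lebesgue. - ?g r z = 0"
    using int[OF \<open>r > 0\<close>] nonpos
    by (subst (asm) integral_nonneg_eq_0_iff_AE) (auto simp: indicator_def)
  then show ?thesis
    by eventually_elim (auto simp: indicator_def)
qed

text \<open>The complement of a closed ball is open and nonempty, hence not a null set.\<close>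

lemma not_AE_lebesgue_bounded:
  assumes "AE z in lebesgue. norm (z :: 'a :: euclidean_space) \<le> R"
  shows False
proof -
  have "- cball 0 R = {z :: 'a. \<not> norm z \<le> R}" by (auto simp: dist_norm)
  with assms have "negligible (- cball (0 :: 'a) R)"
    by (simp add: AE_iff_null_sets negligible_iff_null_sets Compl_eq)
  moreover have "open (- cball (0 :: 'a) R)" by auto
  \<comment> \<open>The absolute value covers a negative \<open>R\<close>.\<close>
  moreover obtain z :: 'a where "norm z = \<bar>R\<bar> + 1"
    using vector_choose_size[of "\<bar>R\<bar> + 1"] by auto
  then have "z \<in> - cball 0 R" by auto
  ultimately show False using open_not_negligible by blast
qed

text \<open>The hypothesis \<open>inf\<close> treats bounded and unbounded domains alike: it follows
  from the sign of \<open>u\<close> outside \<Omega> in the first case and from the liminf condition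
  in the second.\<close>

lemma maximum_principle_F:
  fixes u :: "real ^ 'n \<Rightarrow> real"
  assumes G: "strict_mono G" "G 0 = 0" and "C > 0"
    and "open \<Omega>" and lsc: "lower_semicontinuous_on (closure \<Omega>) u"
    and F: "\<And>x. x \<in> \<Omega> \<Longrightarrow> F_exists \<alpha> G u x \<and> F_op C \<alpha> G u x \<ge> 0"
    and out: "\<And>x. x \<notin> \<Omega> \<Longrightarrow> u x \<ge> 0"
    and inf: "\<And>a. a < 0 \<Longrightarrow> eventually (\<lambda>x. a < u x) at_infinity"
    and "p \<in> \<Omega>"
  shows "u p \<ge> 0"
proof (rule ccontr)
  assume "\<not> u p \<ge> 0"
  then have up: "u p < 0" by simp
  \<comment> \<open>The level lies strictly between \<open>u p\<close> and 0, so far points have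
    values strictly above the minimum; the final contradiction needs this strictness.\<close>
  from inf[of "u p / 2"] up obtain R where R: "\<And>z. norm z \<ge> R \<Longrightarrow> u p / 2 < u z"
    by (auto simp: eventually_at_infinity)
  let ?K = "closure \<Omega> \<inter> cball 0 R"
  have "norm p < R" using R[of p] up by (cases "norm p < R") auto
  then have pK: "p \<in> ?K"
    using \<open>p \<in> \<Omega>\<close> closure_subset by auto
  moreover have "compact ?K"
    by (intro closed_Int_compact) auto
  moreover have "lower_semicontinuous_on ?K u"
    using lsc by (rule lower_semicontinuous_on_subset) auto
  ultimately obtain x where x: "x \<in> ?K" "\<And>y. y \<in> ?K \<Longrightarrow> u x \<le> u y"
    using lower_semicontinuous_on_attains_min[of ?K u] by blast
  have xp: "u x \<le> u p" using x(2) pK by blast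
  \<comment> \<open>Taking the closure for compactness admits boundary points, but these lie outside
    the open set \<Omega>, where \<open>u\<close> is nonnegative.\<close>
  have "x \<in> \<Omega>" using out[of x] xp up by fastforce
  have min: "u x \<le> u z" for z
  proof (cases "z \<in> ?K")
    case True
    then show ?thesis by (rule x(2))
  next
    case False
    then have "z \<notin> \<Omega> \<or> norm z \<ge> R"
      using closure_subset by fastforce
    then show ?thesis
      using R[of z] out[of z] up xp by auto
  qed
  have "F_integrand \<alpha> G u x z \<le> 0" for z
  proof -
    have "G (u x - u z) \<le> G 0"
      using min[of z] G(1) by (simp add: strict_mono_less_eq)
    then show ?thesis
      using G(2) by (simp add: F_integrand_def divide_nonpos_nonneg)
  qed
  \<comment> \<open>The radius 1 is arbitrary; any positive one would do.\<close>
  then have "AE z in lebesgue. z \<notin> ball x 1 \<longrightarrow> F_integrand \<alpha> G u x z = 0"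
    using F[OF \<open>x \<in> \<Omega>\<close>] \<open>C > 0\<close> by (intro F_integrand_eq_0_AE_if_nonpos) auto
  \<comment> \<open>Beyond this radius \<open>z\<close> is both outside \<open>ball x 1\<close> and
    in the region where \<open>u z\<close> exceeds \<open>u x\<close>. The integrand is negative
    there, so all such \<open>z\<close> belong to the exceptional null set.\<close>
  then have "AE z :: real ^ 'n in lebesgue. norm z \<le> max R (norm x + 1)"
  proof eventually_elim
    case (elim z)
    show ?case
    proof (rule ccontr)
      assume "\<not> ?thesis"
      then have z: "norm z > R" "norm z > norm x + 1" by auto
      have "norm (x - z) > 1"
        using z(2) norm_triangle_ineq2[of z x] by (simp add: norm_minus_commute)
      \<comment> \<open>At \<open>z = x\<close> the quotient would be 0 by the convention for
        division by zero; \<open>x \<noteq> z\<close> makes the denominator positive.\<close>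
      then have "z \<notin> ball x 1" and "x \<noteq> z" by (auto simp: dist_norm)
      have "u x - u z < 0" using R[of z] z(1) up xp by simp
      then have "G (u x - u z) < 0"
        using G by (metis strict_mono_less)
      with elim \<open>z \<notin> ball x 1\<close> \<open>x \<noteq> z\<close> show False
        by (simp add: F_integrand_def)
    qed
  qed
  then show False by (rule not_AE_lebesgue_bounded)
qed

theorem theorem1:
  fixes \<alpha> C c0 :: real
    and G :: "real \<Rightarrow> real"
    and \<Omega> :: "(real ^ 'n) set"
    and u :: "real ^ 'n \<Rightarrow> real"
  assumes "0 < \<alpha>" and "\<alpha> < 2"
    and "C > 0"
    and "G C1_differentiable_on UNIV" and "G 0 = 0"
    and "c0 > 0" and "\<forall>t. deriv G t \<ge> c0"
    and "open \<Omega>" and "connected \<Omega>" and "\<Omega> \<noteq> {}"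
    and "C11_loc \<Omega> u" and "u \<in> L_space \<alpha>"
    and "lower_semicontinuous_on (closure \<Omega>) u"
    and "\<forall>x\<in>\<Omega>. F_exists \<alpha> G u x \<and> F_op C \<alpha> G u x \<ge> 0"
    and "\<forall>x\<in>-\<Omega>. u x \<ge> 0"
  shows "(bounded \<Omega> \<longrightarrow> (\<forall>x\<in>\<Omega>. u x \<ge> 0)) \<and>
         (\<not> bounded \<Omega> \<and> Liminf at_infinity (\<lambda>x. ereal (u x)) \<ge> 0 \<longrightarrow> (\<forall>x\<in>\<Omega>. u x \<ge> 0))"
proof -
  have "deriv G t > 0" for t
    using assms(6,7) by (meson less_le_trans)
  with assms(4) have G: "strict_mono G"
    by (rule strict_mono_if_deriv_pos)
  have main: "\<forall>x\<in>\<Omega>. u x \<ge> 0" if "\<And>a. a < 0 \<Longrightarrow> eventually (\<lambda>x. a < u x) at_infinity"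
    using maximum_principle_F[OF G assms(5,3,8,13) _ _ that] assms(14,15) by auto
  show ?thesis
  proof (intro conjI impI)
    assume "bounded \<Omega>"
    then obtain B where B: "\<And>x. x \<in> \<Omega> \<Longrightarrow> norm x \<le> B"
      by (auto simp: bounded_iff)
    show "\<forall>x\<in>\<Omega>. u x \<ge> 0"
    proof (rule main)
      fix a :: real assume "a < 0"
      \<comment> \<open>Such points lie outside \<Omega>, where \<open>u\<close> is
        nonnegative.\<close>
      then have "a < u x" if "norm x \<ge> B + 1" for x
        using B[of x] assms(15) that by (cases "x \<in> \<Omega>") force+
      then show "eventually (\<lambda>x. a < u x) at_infinity"
        by (auto simp: eventually_at_infinity)
    qed
  next
    assume "\<not> bounded \<Omega> \<and> Liminf at_infinity (\<lambda>x. ereal (u x)) \<ge> 0"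
    then have L: "Liminf at_infinity (\<lambda>x. ereal (u x)) \<ge> 0" ..
    show "\<forall>x\<in>\<Omega>. u x \<ge> 0"
    proof (rule main)
      fix a :: real assume "a < 0"
      then have "ereal a < Liminf at_infinity (\<lambda>x. ereal (u x))"
        by (intro less_le_trans[OF _ L]) simp
      then show "eventually (\<lambda>x. a < u x) at_infinity"
        by (auto dest: less_LiminfD)
    qed
  qed
qed

end
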